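(* Let $E=\mathbb Ze_1\oplus\mathbb Ze_2$, $W=\mathbb Zf$, let $\mu:E^{\otimes3}\to W$ be the tensor with $\mu(e_i,e_j,e_k)=-f$ if $(i,j,k)=(2,2,2)$ and $\mu(e_i,e_j,e_k)=f$ otherwise, and let $T_\pm=E\oplus W$ be the corresponding two-step ternary ring. For every odd prime $p$, $$\dim_{\mathbb F_p}\mathfrak D(T_\pm\otimes\mathbb F_p,\mathbb F_p)=2.$$ In characteristic $2$, $$\dim_{\mathbb F_2}\mathfrak D(T_\pm\otimes\mathbb F_2,\mathbb F_2)=4.$$ Thus the defect jump at $2$ equals $2$.
   Context: For a field $k$, $T_\pm\otimes k=E_k\oplus W_k$ ($E_k=E\otimes k$, $W_k=W\otimes k$, $\mu_k$ the scalar extension of $\mu$) with $\Gamma=k$ and ternary operation $(x+u)\,n\,(y+v)\,m\,(z+w)=nm\,\mu_k(x,y,z)$ ($x,y,z\in E_k$; $u,v,w\in W_k$; $n,m\in k$). The operator rng $\mathcal O_k(T,\Gamma)$ is the quotient of $T\otimes_k\Gamma\otimes_kT\otimes_k\Gamma$, with multiplication $(a\otimes\alpha\otimes b\otimes\beta)(c\otimes\gamma\otimes d\otimes\delta)=(a\alpha b\beta c)\otimes\gamma\otimes d\otimes\delta$, by the two-sided ideal generated by all $(a\alpha b\beta c)\otimes\gamma\otimes d\otimes\delta-a\otimes\alpha\otimes(b\beta c\gamma d)\otimes\delta$. The operator defect $\mathfrak D(T,k)$ is the kernel of the regular representation $\mathcal O_k(T,k)\to\operatorname{End}_k(T)$,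 $[a,\alpha,b,\beta]\mapsto(x\mapsto a\alpha b\beta x)$. The defect jump at a prime $p$ is $\dim_{\mathbb F_p}\mathfrak D(T_\pm\otimes\mathbb F_p,\mathbb F_p)-\dim_{\mathbb Q}\mathfrak D(T_\pm\otimes\mathbb Q,\mathbb Q)$. *)

theory Defs
  imports
    "HOL-Analysis.Cartesian_Space"
    "HOL-Library.Poly_Mapping"
    "Berlekamp_Zassenhaus.Finite_Field"
begin

section \<open>The ternary algebra\<close>

text \<open>
  \<open>mu_coeff i j l\<close> is the integer coefficient of \<open>f\<close> in \<open>\<mu>(e\<^sub>i, e\<^sub>j, e\<^sub>l)\<close>.  The index type \<open>2\<close> has
  the two elements \<open>1\<close> and \<open>2\<close> (the latter equal to \<open>0\<close>).  For a commutative ring \<open>'k\<close>,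
  \<open>mu\<close> is the extension of \<open>\<mu>\<close> to \<open>E \<otimes> 'k = 'k ^ 2\<close> with values in \<open>W \<otimes> 'k = 'k\<close>; taking
  \<open>'k = int\<close> gives \<open>\<mu>\<close> itself.
\<close>

definition mu_coeff :: "2 \<Rightarrow> 2 \<Rightarrow> 2 \<Rightarrow> int" where
  "mu_coeff i j l = (if (i, j, l) = (2, 2, 2) then - 1 else 1)"

definition mu :: "'k::comm_ring_1 ^ 2 \<Rightarrow> 'k ^ 2 \<Rightarrow> 'k ^ 2 \<Rightarrow> 'k" where
  "mu x y z = (\<Sum>i\<in>UNIV. \<Sum>j\<in>UNIV. \<Sum>l\<in>UNIV. of_int (mu_coeff i j l) * x $ i * y $ j * z $ l)"

lemma mu_axis:
  "mu (axis i 1) (axis j 1) (axis l 1) = of_int (mu_coeff i j l)"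
proof -
  have *: "of_int (mu_coeff i' j' l') * axis i 1 $ i' * axis j 1 $ j' * axis l 1 $ l'
      = (if l' = l then if j' = j then if i' = i then of_int (mu_coeff i j l) else 0 else 0 else 0)"
    for i' j' l' by (simp add: axis_def)
  show ?thesis unfolding mu_def * by simp
qed

text \<open>
  \<open>'k tpm\<close> is \<open>T\<^sub>\<plusminus> \<otimes> 'k = (E \<otimes> 'k) \<oplus> (W \<otimes> 'k)\<close>.  In \<open>tern a \<alpha> b \<beta> c\<close> the scalars
  \<open>\<alpha>, \<beta>\<close> are elements of \<open>\<Gamma> = 'k\<close>.
\<close>

type_synonym 'k tpm = "('k ^ 2) \<times> 'k"

definition tpm_scale :: "'k::comm_ring_1 \<Rightarrow> 'k tpm \<Rightarrow> 'k tpm" where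
  "tpm_scale c t = (c *s fst t, c * snd t)"

definition tern :: "'k::comm_ring_1 tpm \<Rightarrow> 'k \<Rightarrow> 'k tpm \<Rightarrow> 'k \<Rightarrow> 'k tpm \<Rightarrow> 'k tpm" where
  "tern a \<alpha> b \<beta> c = (0, \<alpha> * \<beta> * mu (fst a) (fst b) (fst c))"

lemma tpm_vector_space: "vector_space (tpm_scale :: 'k::field \<Rightarrow> _)"
  by unfold_locales (auto simp: tpm_scale_def vec_eq_iff algebra_simps)

lemma mu_add:
  "mu (x + x') y z = mu x y z + mu x' y z"
  "mu x (y + y') z = mu x y z + mu x y' z"
  "mu x y (z + z') = mu x y z + mu x y z'"
  by (simp_all add: mu_def algebra_simps sum.distrib)

lemma mu_scale:
  "mu (c *s x) y z = c * mu x y z"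
  "mu x (c *s y) z = c * mu x y z"
  "mu x y (c *s z) = c * mu x y z"
  by (simp_all add: mu_def algebra_simps sum_distrib_left)

lemma mu_zero [simp]: "mu 0 y z = 0" "mu x 0 z = 0" "mu x y 0 = 0"
  by (simp_all add: mu_def)

lemma tern_add:
  "tern (a + a') \<alpha> b \<beta> c = tern a \<alpha> b \<beta> c + tern a' \<alpha> b \<beta> c"
  "tern a (\<alpha> + \<alpha>') b \<beta> c = tern a \<alpha> b \<beta> c + tern a \<alpha>' b \<beta> c"
  "tern a \<alpha> (b + b') \<beta> c = tern a \<alpha> b \<beta> c + tern a \<alpha> b' \<beta> c"
  "tern a \<alpha> b (\<beta> + \<beta>') c = tern a \<alpha> b \<beta> c + tern a \<alpha> b \<beta>' c"
  "tern a \<alpha> b \<beta> (c + c') = tern a \<alpha> b \<beta> c + tern a \<alpha> b \<beta> c'"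
  by (simp_all add: tern_def mu_add algebra_simps)

lemma tern_zero [simp]: "tern a \<alpha> b \<beta> 0 = 0"
  by (simp add: tern_def zero_prod_def)

lemma tern_scale:
  "tern (tpm_scale r a) \<alpha> b \<beta> c = tpm_scale r (tern a \<alpha> b \<beta> c)"
  "tern a (r * \<alpha>) b \<beta> c = tpm_scale r (tern a \<alpha> b \<beta> c)"
  "tern a \<alpha> (tpm_scale r b) \<beta> c = tpm_scale r (tern a \<alpha> b \<beta> c)"
  "tern a \<alpha> b (r * \<beta>) c = tpm_scale r (tern a \<alpha> b \<beta> c)"
  "tern a \<alpha> b \<beta> (tpm_scale r c) = tpm_scale r (tern a \<alpha> b \<beta> c)"
  by (simp_all add: tern_def tpm_scale_def mu_scale)

lemma tern_assoc:
  "tern (tern a \<alpha> b \<beta> c) \<gamma> d \<delta> e = tern a \<alpha> (tern b \<beta> c \<gamma> d) \<delta> e"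
  "tern (tern a \<alpha> b \<beta> c) \<gamma> d \<delta> e = tern a \<alpha> b \<beta> (tern c \<gamma> d \<delta> e)"
  by (simp_all add: tern_def)


section \<open>Free vector spaces\<close>

definition free_scale :: "'k::field \<Rightarrow> ('x \<Rightarrow>\<^sub>0 'k) \<Rightarrow> 'x \<Rightarrow>\<^sub>0 'k" where
  "free_scale c = Poly_Mapping.map ((*) c)"

text \<open>\<open>lin_ext s g\<close> is the linear map with \<open>x \<mapsto> g x\<close> on basis elements, \<open>s\<close> being the scalar
  multiplication of the target.\<close>

definition lin_ext :: "('k::field \<Rightarrow> 'v \<Rightarrow> 'v) \<Rightarrow> ('x \<Rightarrow> 'v) \<Rightarrow> ('x \<Rightarrow>\<^sub>0 'k) \<Rightarrow> 'v::ab_group_add" where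
  "lin_ext s g u = (\<Sum>x\<in>Poly_Mapping.keys u. s (Poly_Mapping.lookup u x) (g x))"

lemma lookup_free_scale [simp]:
  "Poly_Mapping.lookup (free_scale c u) x = c * Poly_Mapping.lookup u x"
  by (simp add: free_scale_def Poly_Mapping.map.rep_eq when_def)

lemma free_vector_space: "vector_space (free_scale :: 'k::field \<Rightarrow> ('x \<Rightarrow>\<^sub>0 'k) \<Rightarrow> _)"
  by unfold_locales (auto intro!: poly_mapping_eqI simp: lookup_add algebra_simps)

lemma vs_linearI:
  assumes "vector_space s1" "vector_space s2"
    and "\<And>x y. f (x + y) = f x + f y" "\<And>r x. f (s1 r x) = s2 r (f x)"
  shows "Vector_Spaces.linear s1 s2 f"
  using assms by (simp add: Vector_Spaces.linear_iff)

lemma lin_ext_superset: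
  assumes "vector_space s" "finite A" "Poly_Mapping.keys u \<subseteq> A"
  shows "lin_ext s g u = (\<Sum>x\<in>A. s (Poly_Mapping.lookup u x) (g x))"
proof -
  interpret vector_space s by fact
  show ?thesis unfolding lin_ext_def
    by (rule sum.mono_neutral_left) (use assms in \<open>auto simp: in_keys_iff\<close>)
qed

lemma lin_ext_single [simp]:
  assumes "vector_space s"
  shows "lin_ext s g (Poly_Mapping.single x 1) = g x"
proof -
  interpret vector_space s by fact
  show ?thesis by (simp add: lin_ext_def)
qed

lemma lin_ext_linear:
  fixes s :: "'k::field \<Rightarrow> 'v \<Rightarrow> 'v::ab_group_add"
  assumes "vector_space s"
  shows "Vector_Spaces.linear free_scale s (lin_ext s (g :: 'x \<Rightarrow> 'v))"
proof -
  interpret t: vector_space s by fact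
  show ?thesis
  proof (rule vs_linearI[OF free_vector_space assms])
    fix u v :: "'x \<Rightarrow>\<^sub>0 'k"
    let ?A = "Poly_Mapping.keys u \<union> Poly_Mapping.keys v"
    have "lin_ext s g (u + v) = (\<Sum>x\<in>?A. s (Poly_Mapping.lookup (u + v) x) (g x))"
      by (rule lin_ext_superset) (use assms keys_add[of u v] in auto)
    also have "\<dots> = (\<Sum>x\<in>?A. s (Poly_Mapping.lookup u x) (g x)) + (\<Sum>x\<in>?A. s (Poly_Mapping.lookup v x) (g x))"
      by (simp add: lookup_add t.scale_left_distrib sum.distrib)
    also have "\<dots> = lin_ext s g u + lin_ext s g v"
      using lin_ext_superset[OF assms, of ?A u g] lin_ext_superset[OF assms, of ?A v g] by simp
    finally show "lin_ext s g (u + v) = lin_ext s g u + lin_ext s g v" .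
  next
    fix c and u :: "'x \<Rightarrow>\<^sub>0 'k"
    have "lin_ext s g (free_scale c u)
        = (\<Sum>x\<in>Poly_Mapping.keys u. s (Poly_Mapping.lookup (free_scale c u) x) (g x))"
      by (rule lin_ext_superset) (use assms in \<open>auto simp: in_keys_iff\<close>)
    also have "\<dots> = s c (lin_ext s g u)"
      by (simp add: lin_ext_def t.scale_sum_right)
    finally show "lin_ext s g (free_scale c u) = s c (lin_ext s g u)" .
  qed
qed

lemma free_span_singles:
  fixes u :: "'x \<Rightarrow>\<^sub>0 'k::field"
  shows "u \<in> module.span free_scale (range (\<lambda>x. Poly_Mapping.single x (1::'k)))"
proof -
  interpret f: vector_space "free_scale :: 'k \<Rightarrow> ('x \<Rightarrow>\<^sub>0 'k) \<Rightarrow> _" by (rule free_vector_space)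
  have "u = (\<Sum>x\<in>Poly_Mapping.keys u. free_scale (Poly_Mapping.lookup u x) (Poly_Mapping.single x 1))"
    by (rule poly_mapping_eqI)
       (auto simp: lookup_sum lookup_single when_def in_keys_iff if_distrib sum.delta cong: if_cong)
  also have "\<dots> \<in> f.span (range (\<lambda>x. Poly_Mapping.single x (1::'k)))"
    by (intro f.span_sum f.span_scale f.span_base) auto
  finally show ?thesis .
qed


section \<open>The tensor product \<open>T \<otimes> \<Gamma> \<otimes> T \<otimes> \<Gamma>\<close> with \<open>\<Gamma> = 'k\<close>\<close>

type_synonym 'k free4 = "('k tpm \<times> 'k \<times> 'k tpm \<times> 'k) \<Rightarrow>\<^sub>0 'k"

abbreviation gen4 :: "'k::field tpm \<Rightarrow> 'k \<Rightarrow> 'k tpm \<Rightarrow> 'k \<Rightarrow> 'k free4" where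
  "gen4 a \<alpha> b \<beta> \<equiv> Poly_Mapping.single (a, \<alpha>, b, \<beta>) 1"

inductive_set multilin_rels :: "'k::field free4 set" where
  "gen4 (a + a') \<alpha> b \<beta> - gen4 a \<alpha> b \<beta> - gen4 a' \<alpha> b \<beta> \<in> multilin_rels"
| "gen4 a (\<alpha> + \<alpha>') b \<beta> - gen4 a \<alpha> b \<beta> - gen4 a \<alpha>' b \<beta> \<in> multilin_rels"
| "gen4 a \<alpha> (b + b') \<beta> - gen4 a \<alpha> b \<beta> - gen4 a \<alpha> b' \<beta> \<in> multilin_rels"
| "gen4 a \<alpha> b (\<beta> + \<beta>') - gen4 a \<alpha> b \<beta> - gen4 a \<alpha> b \<beta>' \<in> multilin_rels"
| "gen4 (tpm_scale r a) \<alpha> b \<beta> - free_scale r (gen4 a \<alpha> b \<beta>) \<in> multilin_rels"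
| "gen4 a (r * \<alpha>) b \<beta> - free_scale r (gen4 a \<alpha> b \<beta>) \<in> multilin_rels"
| "gen4 a \<alpha> (tpm_scale r b) \<beta> - free_scale r (gen4 a \<alpha> b \<beta>) \<in> multilin_rels"
| "gen4 a \<alpha> b (r * \<beta>) - free_scale r (gen4 a \<alpha> b \<beta>) \<in> multilin_rels"

definition multilin_null :: "'k::field free4 set" where
  "multilin_null = module.span free_scale multilin_rels"

definition free4_mult :: "'k::field free4 \<Rightarrow> 'k free4 \<Rightarrow> 'k free4" where
  "free4_mult u v =
     lin_ext free_scale (\<lambda>(a, \<alpha>, b, \<beta>).
       lin_ext free_scale (\<lambda>(c, \<gamma>, d, \<delta>). gen4 (tern a \<alpha> b \<beta> c) \<gamma> d \<delta>) v) u"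

definition free4_act :: "'k::field free4 \<Rightarrow> 'k tpm \<Rightarrow> 'k tpm" where
  "free4_act u x = lin_ext tpm_scale (\<lambda>(a, \<alpha>, b, \<beta>). tern a \<alpha> b \<beta> x) u"

interpretation free4: vector_space "free_scale :: 'k::field \<Rightarrow> 'k free4 \<Rightarrow> 'k free4"
  by (rule free_vector_space)

lemma multilin_null_subspace: "free4.subspace (multilin_null :: 'k::field free4 set)"
  by (simp add: multilin_null_def)

lemma free4_mult_linear_left:
  "Vector_Spaces.linear free_scale free_scale (\<lambda>u. free4_mult u (v :: 'k::field free4))"
  unfolding free4_mult_def by (rule lin_ext_linear) (rule free_vector_space)

lemma free4_mult_gen4_left:
  "free4_mult (gen4 a \<alpha> b \<beta>) v = lin_ext free_scale (\<lambda>(c, \<gamma>, d, \<delta>). gen4 (tern a \<alpha> b \<beta> c) \<gamma> d \<delta>) v"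
  by (simp add: free4_mult_def free_vector_space)

lemma free4_mult_linear_right:
  "Vector_Spaces.linear free_scale free_scale (\<lambda>v. free4_mult (u :: 'k::field free4) v)"
proof -
  interpret vector_space_pair "free_scale :: 'k \<Rightarrow> 'k free4 \<Rightarrow> _" "free_scale :: 'k \<Rightarrow> 'k free4 \<Rightarrow> _"
    by unfold_locales
  have eq: "(\<lambda>v. free4_mult u v) = (\<lambda>v. \<Sum>x\<in>Poly_Mapping.keys u.
      free_scale (Poly_Mapping.lookup u x)
        (lin_ext free_scale (\<lambda>(c, \<gamma>, d, \<delta>). case x of (a, \<alpha>, b, \<beta>) \<Rightarrow> gen4 (tern a \<alpha> b \<beta> c) \<gamma> d \<delta>) v))"
    by (rule ext) (simp add: free4_mult_def lin_ext_def[of _ _ u] case_prod_unfold)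
  show ?thesis unfolding eq
    by (intro linear_compose_sum ballI linear_compose_scale_right lin_ext_linear free_vector_space)
qed

lemma free4_mult_gen4:
  "free4_mult (gen4 a \<alpha> b \<beta>) (gen4 c \<gamma> d \<delta>) = gen4 (tern a \<alpha> b \<beta> c) \<gamma> d \<delta>"
  by (simp add: free4_mult_gen4_left free_vector_space)

lemma free4_induct:
  fixes u :: "'k::field free4"
  assumes "\<And>a \<alpha> b \<beta>. gen4 a \<alpha> b \<beta> \<in> S" "free4.subspace S"
  shows "u \<in> S"
proof -
  have "free4.span (range (\<lambda>x. Poly_Mapping.single x (1::'k))) \<subseteq> S"
    by (rule free4.span_minimal) (use assms in auto)
  thus ?thesis using free_span_singles[of u] by blast
qed

lemma linear_subspace_vimage:
  assumes "Vector_Spaces.linear s1 s2 f" "module.subspace s2 S"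
  shows "module.subspace s1 {x. f x \<in> S}"
proof -
  interpret Vector_Spaces.linear s1 s2 f by fact
  have "{x. f x \<in> S} = f -` S" by auto
  thus ?thesis using subspace_vimage[OF assms(2)] by simp
qed

lemma free4_mult_null_left:
  fixes u :: "'a::field free4"
  assumes "u \<in> multilin_null"
  shows "free4_mult u v \<in> multilin_null"
proof -
  interpret L: Vector_Spaces.linear "free_scale :: 'a \<Rightarrow> 'a free4 \<Rightarrow> _" free_scale "\<lambda>u. free4_mult u z" for z
    by (rule free4_mult_linear_left)
  interpret R: Vector_Spaces.linear "free_scale :: 'a \<Rightarrow> 'a free4 \<Rightarrow> _" free_scale "\<lambda>w. free4_mult z w" for z
    by (rule free4_mult_linear_right)
  have "multilin_rels \<subseteq> {u. free4_mult u v \<in> multilin_null}"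
  proof
    fix r :: "'a free4" assume r: "r \<in> multilin_rels"
    have "v \<in> {v. free4_mult r v \<in> multilin_null}"
    proof (rule free4_induct)
      fix c \<gamma> d \<delta>
      have "free4_mult r (gen4 c \<gamma> d \<delta>) \<in> multilin_null"
        using r unfolding multilin_null_def
        by cases (auto simp: L.diff L.scale free4_mult_gen4 tern_add tern_scale
              intro!: free4.span_base multilin_rels.intros)
      thus "gen4 c \<gamma> d \<delta> \<in> {v. free4_mult r v \<in> multilin_null}" by simp
    qed (rule linear_subspace_vimage[OF free4_mult_linear_right multilin_null_subspace])
    thus "r \<in> {u. free4_mult u v \<in> multilin_null}" by simp
  qed
  hence "free4.span multilin_rels \<subseteq> {u. free4_mult u v \<in> multilin_null}"
    by (rule free4.span_minimal) (rule linear_subspace_vimage[OF free4_mult_linear_left multilin_null_subspace])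
  thus ?thesis using assms unfolding multilin_null_def by blast
qed

lemma free4_mult_null_right:
  fixes v :: "'a::field free4"
  assumes "v \<in> multilin_null"
  shows "free4_mult u v \<in> multilin_null"
proof -
  interpret R: Vector_Spaces.linear "free_scale :: 'a \<Rightarrow> 'a free4 \<Rightarrow> _" free_scale "\<lambda>w. free4_mult z w" for z
    by (rule free4_mult_linear_right)
  have "u \<in> {u. free4_mult u v \<in> multilin_null}"
  proof (rule free4_induct)
    fix a b :: "'a tpm" and \<alpha> \<beta> :: 'a
    have "multilin_rels \<subseteq> {v. free4_mult (gen4 a \<alpha> b \<beta>) v \<in> multilin_null}"
    proof
      fix r :: "'a free4" assume r: "r \<in> multilin_rels"
      have "free4_mult (gen4 a \<alpha> b \<beta>) r \<in> multilin_null"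
        using r unfolding multilin_null_def
        by cases (auto simp: R.diff R.scale free4_mult_gen4 tern_add tern_scale
              intro!: free4.span_base multilin_rels.intros)
      thus "r \<in> {v. free4_mult (gen4 a \<alpha> b \<beta>) v \<in> multilin_null}" by simp
    qed
    hence "free4.span multilin_rels \<subseteq> {v. free4_mult (gen4 a \<alpha> b \<beta>) v \<in> multilin_null}"
      by (rule free4.span_minimal) (rule linear_subspace_vimage[OF free4_mult_linear_right multilin_null_subspace])
    thus "gen4 a \<alpha> b \<beta> \<in> {u. free4_mult u v \<in> multilin_null}"
      using assms unfolding multilin_null_def by blast
  qed (rule linear_subspace_vimage[OF free4_mult_linear_left multilin_null_subspace])
  thus ?thesis by simp
qed

lemma free4_act_linear:
  "Vector_Spaces.linear free_scale tpm_scale (\<lambda>u. free4_act (u :: 'k::field free4) x)"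
  unfolding free4_act_def by (rule lin_ext_linear) (rule tpm_vector_space)

lemma free4_act_gen4 [simp]: "free4_act (gen4 a \<alpha> b \<beta>) x = tern a \<alpha> b \<beta> x"
  by (simp add: free4_act_def tpm_vector_space)

lemma free4_act_null:
  fixes u :: "'a::field free4"
  assumes "u \<in> multilin_null"
  shows "free4_act u x = 0"
proof -
  interpret A: Vector_Spaces.linear "free_scale :: 'a \<Rightarrow> 'a free4 \<Rightarrow> _" tpm_scale "\<lambda>u. free4_act u x"
    by (rule free4_act_linear)
  have "free4_act r x = 0" if "r \<in> multilin_rels" for r
    using that by cases (simp_all add: A.diff A.scale tern_add tern_scale)
  thus ?thesis using A.eq_0_on_span[of multilin_rels u] assms unfolding multilin_null_def by blast
qed

definition tensor_rel :: "'k::field free4 \<Rightarrow> 'k free4 \<Rightarrow> bool" where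
  "tensor_rel u v \<longleftrightarrow> u - v \<in> multilin_null"

lemma tensor_rel_equivp: "equivp (tensor_rel :: 'k::field free4 \<Rightarrow> _)"
proof (rule equivpI)
  note S = multilin_null_subspace
  show "reflp (tensor_rel :: 'k free4 \<Rightarrow> _)"
    by (auto intro!: reflpI simp: tensor_rel_def free4.subspace_0[OF S])
  show "symp (tensor_rel :: 'k free4 \<Rightarrow> _)"
    using free4.subspace_neg[OF S] by (fastforce intro!: sympI simp: tensor_rel_def)
  show "transp (tensor_rel :: 'k free4 \<Rightarrow> _)"
  proof (rule transpI)
    fix u v w :: "'k free4" assume "tensor_rel u v" "tensor_rel v w"
    thus "tensor_rel u w" using free4.subspace_add[OF S, of "u - v" "v - w"]
      by (simp add: tensor_rel_def)
  qed
qed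

quotient_type (overloaded) 'k tensor4 = "'k::field free4" / tensor_rel
  by (rule tensor_rel_equivp)

lift_definition tensor4_scale :: "'k::field \<Rightarrow> 'k tensor4 \<Rightarrow> 'k tensor4" is free_scale
  using free4.subspace_scale[OF multilin_null_subspace]
  by (fastforce simp: tensor_rel_def free4.scale_right_diff_distrib[symmetric])

lift_definition pure4 :: "'k::field tpm \<Rightarrow> 'k \<Rightarrow> 'k tpm \<Rightarrow> 'k \<Rightarrow> 'k tensor4" is gen4 .

lift_definition tensor4_act :: "'k::field tensor4 \<Rightarrow> 'k tpm \<Rightarrow> 'k tpm" is free4_act
proof (rule ext)
  fix u v :: "'k free4" and x
  interpret A: Vector_Spaces.linear "free_scale :: 'k \<Rightarrow> 'k free4 \<Rightarrow> _" tpm_scale "\<lambda>u. free4_act u x"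
    by (rule free4_act_linear)
  assume "tensor_rel u v"
  thus "free4_act u x = free4_act v x"
    using free4_act_null[of "u - v" x] by (simp add: tensor_rel_def A.diff)
qed

instantiation tensor4 :: (field) ring
begin

lift_definition zero_tensor4 :: "'a tensor4" is 0 .

lift_definition plus_tensor4 :: "'a tensor4 \<Rightarrow> 'a tensor4 \<Rightarrow> 'a tensor4" is "(+)"
  unfolding tensor_rel_def add_diff_add by (rule free4.subspace_add[OF multilin_null_subspace])

lift_definition uminus_tensor4 :: "'a tensor4 \<Rightarrow> 'a tensor4" is uminus
  using free4.subspace_neg[OF multilin_null_subspace] by (fastforce simp: tensor_rel_def)

lift_definition minus_tensor4 :: "'a tensor4 \<Rightarrow> 'a tensor4 \<Rightarrow> 'a tensor4" is "(-)"
proof -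
  fix u u' v v' :: "'a free4" assume "tensor_rel u u'" "tensor_rel v v'"
  thus "tensor_rel (u - v) (u' - v')"
    using free4.subspace_diff[OF multilin_null_subspace, of "u - u'" "v - v'"]
    by (simp add: tensor_rel_def algebra_simps)
qed

lift_definition times_tensor4 :: "'a tensor4 \<Rightarrow> 'a tensor4 \<Rightarrow> 'a tensor4" is free4_mult
proof -
  fix u u' v v' :: "'a free4" assume *: "tensor_rel u u'" "tensor_rel v v'"
  interpret L: Vector_Spaces.linear "free_scale :: 'a \<Rightarrow> 'a free4 \<Rightarrow> _" free_scale "\<lambda>u. free4_mult u z" for z
    by (rule free4_mult_linear_left)
  interpret R: Vector_Spaces.linear "free_scale :: 'a \<Rightarrow> 'a free4 \<Rightarrow> _" free_scale "\<lambda>w. free4_mult z w" for z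
    by (rule free4_mult_linear_right)
  have "free4_mult u v - free4_mult u' v' = free4_mult (u - u') v + free4_mult u' (v - v')"
    by (simp add: L.diff R.diff)
  also have "\<dots> \<in> multilin_null"
    using free4_mult_null_left[of "u - u'" v] free4_mult_null_right[of "v - v'" u'] *
    by (auto simp: tensor_rel_def intro: free4.subspace_add[OF multilin_null_subspace])
  finally show "tensor_rel (free4_mult u v) (free4_mult u' v')" by (simp add: tensor_rel_def)
qed

instance
proof
  have refl: "tensor_rel u u" for u :: "'a free4"
    using tensor_rel_equivp by (rule equivp_reflp)
  interpret L: Vector_Spaces.linear "free_scale :: 'a \<Rightarrow> 'a free4 \<Rightarrow> _" free_scale "\<lambda>u. free4_mult u z" for z
    by (rule free4_mult_linear_left)
  interpret R: Vector_Spaces.linear "free_scale :: 'a \<Rightarrow> 'a free4 \<Rightarrow> _" free_scale "\<lambda>w. free4_mult z w" for z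
    by (rule free4_mult_linear_right)
  have assoc: "free4_mult (free4_mult u v) w = free4_mult u (free4_mult v w)" for u v w :: "'a free4"
  proof -
    interpret vector_space_pair "free_scale :: 'a \<Rightarrow> 'a free4 \<Rightarrow> _" "free_scale :: 'a \<Rightarrow> 'a free4 \<Rightarrow> _"
      by unfold_locales
    have "u \<in> {u. free4_mult (free4_mult u v) w = free4_mult u (free4_mult v w)}"
    proof (rule free4_induct)
      fix a \<alpha> b \<beta>
      have "v \<in> {v. free4_mult (free4_mult (gen4 a \<alpha> b \<beta>) v) w = free4_mult (gen4 a \<alpha> b \<beta>) (free4_mult v w)}"
      proof (rule free4_induct)
        fix c \<gamma> d \<delta>
        have "w \<in> {w. free4_mult (free4_mult (gen4 a \<alpha> b \<beta>) (gen4 c \<gamma> d \<delta>)) w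
                    = free4_mult (gen4 a \<alpha> b \<beta>) (free4_mult (gen4 c \<gamma> d \<delta>) w)}"
          by (rule free4_induct) (auto simp: free4_mult_gen4 tern_assoc(2) R.add R.scale R.zero
              intro!: free4.subspaceI)
        thus "gen4 c \<gamma> d \<delta> \<in> {v. free4_mult (free4_mult (gen4 a \<alpha> b \<beta>) v) w
            = free4_mult (gen4 a \<alpha> b \<beta>) (free4_mult v w)}" by simp
      qed (auto intro!: free4.subspaceI simp: R.add R.scale R.zero L.add L.scale L.zero)
      thus "gen4 a \<alpha> b \<beta> \<in> {u. free4_mult (free4_mult u v) w = free4_mult u (free4_mult v w)}" by simp
    qed (auto intro!: free4.subspaceI simp: L.add L.scale L.zero)
    thus ?thesis by simp
  qed
  fix a b c :: "'a tensor4"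
  show "a + b + c = a + (b + c)" by transfer (simp add: add.assoc refl)
  show "a + b = b + a" by transfer (simp add: add.commute refl)
  show "0 + a = a" by transfer (simp add: refl)
  show "- a + a = 0" by transfer (simp add: refl)
  show "a - b = a + - b" by transfer (simp add: refl)
  show "a * b * c = a * (b * c)" by transfer (simp add: assoc refl)
  show "(a + b) * c = a * c + b * c" by transfer (simp add: L.add refl)
  show "a * (b + c) = a * b + a * c" by transfer (simp add: R.add refl)
qed

end

lemma pure4_mult: "pure4 a \<alpha> b \<beta> * pure4 c \<gamma> d \<delta> = pure4 (tern a \<alpha> b \<beta> c) \<gamma> d \<delta>"
  by transfer (simp add: free4_mult_gen4 equivp_reflp[OF tensor_rel_equivp])

lemma tensor4_act_pure4 [simp]: "tensor4_act (pure4 a \<alpha> b \<beta>) x = tern a \<alpha> b \<beta> x"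
  by transfer simp

lemma tensor4_vector_space: "vector_space (tensor4_scale :: 'k::field \<Rightarrow> _)"
proof
  have refl: "tensor_rel u u" for u :: "'k free4"
    using tensor_rel_equivp by (rule equivp_reflp)
  fix r s :: 'k and x y :: "'k tensor4"
  show "tensor4_scale r (x + y) = tensor4_scale r x + tensor4_scale r y"
    by transfer (simp add: free4.scale_right_distrib refl)
  show "tensor4_scale (r + s) x = tensor4_scale r x + tensor4_scale s x"
    by transfer (simp add: free4.scale_left_distrib refl)
  show "tensor4_scale r (tensor4_scale s x) = tensor4_scale (r * s) x"
    by transfer (simp add: refl)
  show "tensor4_scale 1 x = x"
    by transfer (simp add: refl)
qed

lemma tensor4_scale_mult:
  "tensor4_scale r (x * y) = tensor4_scale r x * y"
  "tensor4_scale r (x * y) = x * tensor4_scale r y"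
proof -
  have refl: "tensor_rel u u" for u :: "'a free4"
    using tensor_rel_equivp by (rule equivp_reflp)
  interpret L: Vector_Spaces.linear "free_scale :: 'a \<Rightarrow> 'a free4 \<Rightarrow> _" free_scale "\<lambda>u. free4_mult u z" for z
    by (rule free4_mult_linear_left)
  interpret R: Vector_Spaces.linear "free_scale :: 'a \<Rightarrow> 'a free4 \<Rightarrow> _" free_scale "\<lambda>w. free4_mult z w" for z
    by (rule free4_mult_linear_right)
  show "tensor4_scale r (x * y) = tensor4_scale r x * y" by transfer (simp add: L.scale refl)
  show "tensor4_scale r (x * y) = x * tensor4_scale r y" by transfer (simp add: R.scale refl)
qed

lemma pure4_scale: "pure4 (tpm_scale r a) \<alpha> b \<beta> = tensor4_scale r (pure4 a \<alpha> b \<beta>)"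
  by transfer (auto simp: tensor_rel_def multilin_null_def intro: free4.span_base multilin_rels.intros)

lemma tensor4_act_linear:
  "Vector_Spaces.linear tensor4_scale tpm_scale (\<lambda>t. tensor4_act (t :: 'k::field tensor4) x)"
proof -
  interpret A: Vector_Spaces.linear "free_scale :: 'k \<Rightarrow> 'k free4 \<Rightarrow> _" tpm_scale "\<lambda>u. free4_act u z" for z
    by (rule free4_act_linear)
  show ?thesis
  proof (rule vs_linearI[OF tensor4_vector_space tpm_vector_space])
    show "tensor4_act (u + v) x = tensor4_act u x + tensor4_act v x" for u v
      by transfer (simp add: A.add)
    show "tensor4_act (tensor4_scale r u) x = tpm_scale r (tensor4_act u x)" for r u
      by transfer (simp add: A.scale)
  qed
qed

lemma tensor4_act_add: "tensor4_act (s + t) x = tensor4_act s x + tensor4_act t x"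
proof -
  interpret A: Vector_Spaces.linear "tensor4_scale :: 'a \<Rightarrow> _" tpm_scale "\<lambda>t. tensor4_act t x"
    by (rule tensor4_act_linear)
  show ?thesis by (rule A.add)
qed

lemma tensor4_act_minus: "tensor4_act (s - t) x = tensor4_act s x - tensor4_act t x"
  using tensor4_act_add[of "s - t" t x] by (simp add: algebra_simps)

lemma tensor4_act_zero [simp]: "tensor4_act 0 x = 0"
  using tensor4_act_minus[of 0 0 x] by simp

lemma tensor4_act_uminus: "tensor4_act (- t) x = - tensor4_act t x"
  using tensor4_act_minus[of 0 t x] by simp

lemma free4_act_vec_linear:
  "Vector_Spaces.linear tpm_scale tpm_scale (free4_act (u :: 'k::field free4))"
proof -
  interpret t: vector_space "tpm_scale :: 'k \<Rightarrow> _" by (rule tpm_vector_space)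
  show ?thesis
    by (rule vs_linearI[OF tpm_vector_space tpm_vector_space])
       (simp_all add: free4_act_def lin_ext_def case_prod_unfold tern_add tern_scale
          t.scale_right_distrib sum.distrib t.scale_sum_right mult.commute)
qed

lemma tensor4_act_vec_linear:
  "Vector_Spaces.linear tpm_scale tpm_scale (tensor4_act (t :: 'k::field tensor4))"
  by transfer (rule free4_act_vec_linear)

lemma tensor4_act_mult: "tensor4_act (s * t) x = tensor4_act s (tensor4_act t x)"
proof -
  have "free4_act (free4_mult u v) x = free4_act u (free4_act v x)" for u v :: "'a free4"
  proof -
    interpret L: Vector_Spaces.linear "free_scale :: 'a \<Rightarrow> 'a free4 \<Rightarrow> _" free_scale "\<lambda>u. free4_mult u z" for z
      by (rule free4_mult_linear_left)
    interpret R: Vector_Spaces.linear "free_scale :: 'a \<Rightarrow> 'a free4 \<Rightarrow> _" free_scale "\<lambda>w. free4_mult z w" for z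
      by (rule free4_mult_linear_right)
    interpret A: Vector_Spaces.linear "free_scale :: 'a \<Rightarrow> 'a free4 \<Rightarrow> _" tpm_scale "\<lambda>u. free4_act u z" for z
      by (rule free4_act_linear)
    interpret B: Vector_Spaces.linear "tpm_scale :: 'a \<Rightarrow> 'a tpm \<Rightarrow> _" tpm_scale "free4_act z" for z
      by (rule free4_act_vec_linear)
    have "u \<in> {u. free4_act (free4_mult u v) x = free4_act u (free4_act v x)}"
    proof (rule free4_induct)
      fix a \<alpha> b \<beta>
      have "v \<in> {v. free4_act (free4_mult (gen4 a \<alpha> b \<beta>) v) x = free4_act (gen4 a \<alpha> b \<beta>) (free4_act v x)}"
        by (rule free4_induct)
           (auto simp: free4_mult_gen4 tern_assoc(2) R.add R.scale R.zero A.add A.scale A.zero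
              tern_add tern_scale tern_zero intro!: free4.subspaceI)
      thus "gen4 a \<alpha> b \<beta> \<in> {u. free4_act (free4_mult u v) x = free4_act u (free4_act v x)}" by simp
    qed (auto intro!: free4.subspaceI simp: L.add L.scale L.zero A.add A.scale A.zero)
    thus ?thesis by simp
  qed
  thus ?thesis by transfer simp
qed


section \<open>The operator rng, its regular representation and the defect\<close>

definition two_sided_ideal :: "'r::ring set \<Rightarrow> bool" where
  "two_sided_ideal I \<longleftrightarrow>
     0 \<in> I \<and> (\<forall>x\<in>I. \<forall>y\<in>I. x + y \<in> I) \<and> (\<forall>x\<in>I. - x \<in> I) \<and>
     (\<forall>x\<in>I. \<forall>r. r * x \<in> I \<and> x * r \<in> I)"

text \<open>
  The rng ideal is generated without closing under \<open>'k\<close>-scaling; since \<open>assoc_rels\<close> is itself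
  closed under scaling, so is the ideal (\<open>operator_ideal_scale\<close> below).
\<close>

definition assoc_rels :: "'k::field tensor4 set" where
  "assoc_rels =
     {pure4 (tern a \<alpha> b \<beta> c) \<gamma> d \<delta> - pure4 a \<alpha> (tern b \<beta> c \<gamma> d) \<delta> | a \<alpha> b \<beta> c \<gamma> d \<delta>. True}"

definition operator_ideal :: "'k::field tensor4 set" where
  "operator_ideal = two_sided_ideal hull assoc_rels"

lemma operator_ideal_ideal: "two_sided_ideal (operator_ideal :: 'k::field tensor4 set)"
  unfolding operator_ideal_def by (rule hull_in) (auto simp: two_sided_ideal_def)

lemma assoc_rels_subset: "assoc_rels \<subseteq> operator_ideal"
  unfolding operator_ideal_def by (rule hull_subset)

lemma operator_ideal_minimal:
  "assoc_rels \<subseteq> I \<Longrightarrow> two_sided_ideal I \<Longrightarrow> operator_ideal \<subseteq> I"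
  unfolding operator_ideal_def by (rule hull_minimal)

lemma operator_ideal_diff: "x \<in> operator_ideal \<Longrightarrow> y \<in> operator_ideal \<Longrightarrow> x - y \<in> operator_ideal"
  using operator_ideal_ideal unfolding two_sided_ideal_def by (metis diff_conv_add_uminus)

lemma operator_ideal_scale:
  fixes t :: "'a::field tensor4"
  assumes "t \<in> operator_ideal"
  shows "tensor4_scale r t \<in> operator_ideal"
proof -
  interpret T: vector_space "tensor4_scale :: 'a \<Rightarrow> _" by (rule tensor4_vector_space)
  have "operator_ideal \<subseteq> {t :: 'a tensor4. tensor4_scale r t \<in> operator_ideal}"
  proof (rule operator_ideal_minimal)
    have "tensor4_scale r t \<in> assoc_rels" if "t \<in> assoc_rels" for t
    proof -
      from that obtain a \<alpha> b \<beta> c \<gamma> d \<delta> where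
        t: "t = pure4 (tern a \<alpha> b \<beta> c) \<gamma> d \<delta> - pure4 a \<alpha> (tern b \<beta> c \<gamma> d) \<delta>"
        unfolding assoc_rels_def by blast
      have "tensor4_scale r t = pure4 (tern (tpm_scale r a) \<alpha> b \<beta> c) \<gamma> d \<delta>
          - pure4 (tpm_scale r a) \<alpha> (tern b \<beta> c \<gamma> d) \<delta>"
        by (simp add: t T.scale_right_diff_distrib pure4_scale tern_scale)
      thus ?thesis unfolding assoc_rels_def by blast
    qed
    thus "assoc_rels \<subseteq> {t. tensor4_scale r t \<in> operator_ideal}"
      using assoc_rels_subset by auto
    show "two_sided_ideal {t. tensor4_scale r t \<in> operator_ideal}"
      unfolding two_sided_ideal_def mem_Collect_eq
    proof (intro conjI ballI allI)
      note I = operator_ideal_ideal[where 'k = 'a, unfolded two_sided_ideal_def]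
      fix x y z :: "'a tensor4"
      assume x: "x \<in> {t. tensor4_scale r t \<in> operator_ideal}"
      show "tensor4_scale r (x + y) \<in> operator_ideal" if "y \<in> {t. tensor4_scale r t \<in> operator_ideal}"
        using that x I by (auto simp: T.scale_right_distrib)
      show "tensor4_scale r (- x) \<in> operator_ideal" using x I by simp
      show "tensor4_scale r (z * x) \<in> operator_ideal" using x I by (simp add: tensor4_scale_mult(2))
      show "tensor4_scale r (x * z) \<in> operator_ideal" using x I by (simp add: tensor4_scale_mult(1))
    qed (use operator_ideal_ideal[where 'k = 'a, unfolded two_sided_ideal_def] in simp)
  qed
  thus ?thesis using assms by blast
qed

lemma operator_ideal_act:
  fixes t :: "'a::field tensor4"
  assumes "t \<in> operator_ideal"
  shows "tensor4_act t x = 0"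
proof -
  interpret B: Vector_Spaces.linear "tpm_scale :: 'a \<Rightarrow> 'a tpm \<Rightarrow> _" tpm_scale "tensor4_act z" for z
    by (rule tensor4_act_vec_linear)
  have "operator_ideal \<subseteq> {t :: 'a tensor4. \<forall>x. tensor4_act t x = 0}"
  proof (rule operator_ideal_minimal)
    show "assoc_rels \<subseteq> {t :: 'a tensor4. \<forall>x. tensor4_act t x = 0}"
      by (auto simp: assoc_rels_def tensor4_act_minus tern_assoc(1))
    show "two_sided_ideal {t :: 'a tensor4. \<forall>x. tensor4_act t x = 0}"
      by (simp add: two_sided_ideal_def tensor4_act_add tensor4_act_uminus tensor4_act_mult B.zero
          del: split_paired_All)
  qed
  thus ?thesis using assms by blast
qed

definition operator_rel :: "'k::field tensor4 \<Rightarrow> 'k tensor4 \<Rightarrow> bool" where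
  "operator_rel s t \<longleftrightarrow> s - t \<in> operator_ideal"

lemma operator_rel_equivp: "equivp (operator_rel :: 'k::field tensor4 \<Rightarrow> _)"
proof (rule equivpI)
  note I = operator_ideal_ideal[where 'k = 'k, unfolded two_sided_ideal_def]
  show "reflp (operator_rel :: 'k tensor4 \<Rightarrow> _)"
    using I by (auto intro!: reflpI simp: operator_rel_def)
  show "symp (operator_rel :: 'k tensor4 \<Rightarrow> _)"
    using I by (fastforce intro!: sympI simp: operator_rel_def)
  show "transp (operator_rel :: 'k tensor4 \<Rightarrow> _)"
  proof (rule transpI)
    fix u v w :: "'k tensor4" assume "operator_rel u v" "operator_rel v w"
    hence "(u - v) + (v - w) \<in> operator_ideal" using I unfolding operator_rel_def by blast
    thus "operator_rel u w" by (simp add: operator_rel_def)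
  qed
qed

quotient_type (overloaded) 'k operator_rng = "'k::field tensor4" / operator_rel
  by (rule operator_rel_equivp)

lift_definition operator_scale :: "'k::field \<Rightarrow> 'k operator_rng \<Rightarrow> 'k operator_rng" is tensor4_scale
proof -
  interpret T: vector_space "tensor4_scale :: 'k \<Rightarrow> _" by (rule tensor4_vector_space)
  fix r :: 'k and s t :: "'k tensor4" assume "operator_rel s t"
  thus "operator_rel (tensor4_scale r s) (tensor4_scale r t)"
    using operator_ideal_scale[of "s - t" r]
    by (simp add: operator_rel_def T.scale_right_diff_distrib)
qed

lift_definition operator_class :: "'k::field tpm \<Rightarrow> 'k \<Rightarrow> 'k tpm \<Rightarrow> 'k \<Rightarrow> 'k operator_rng" is pure4 .

lift_definition regular_rep :: "'k::field operator_rng \<Rightarrow> 'k tpm \<Rightarrow> 'k tpm" is tensor4_act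
proof (rule ext)
  fix s t :: "'k tensor4" and x assume "operator_rel s t"
  thus "tensor4_act s x = tensor4_act t x"
    using operator_ideal_act[of "s - t" x] by (simp add: operator_rel_def tensor4_act_minus)
qed

instantiation operator_rng :: (field) ring
begin

lift_definition zero_operator_rng :: "'a operator_rng" is 0 .

lift_definition plus_operator_rng :: "'a operator_rng \<Rightarrow> 'a operator_rng \<Rightarrow> 'a operator_rng" is "(+)"
  unfolding operator_rel_def add_diff_add
  using operator_ideal_ideal unfolding two_sided_ideal_def by blast

lift_definition uminus_operator_rng :: "'a operator_rng \<Rightarrow> 'a operator_rng" is uminus
  using operator_ideal_ideal unfolding two_sided_ideal_def by (fastforce simp: operator_rel_def)

lift_definition minus_operator_rng :: "'a operator_rng \<Rightarrow> 'a operator_rng \<Rightarrow> 'a operator_rng" is "(-)"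
proof -
  fix u u' v v' :: "'a tensor4" assume "operator_rel u u'" "operator_rel v v'"
  thus "operator_rel (u - v) (u' - v')"
    using operator_ideal_diff[of "u - u'" "v - v'"]
    by (simp add: operator_rel_def algebra_simps)
qed

lift_definition times_operator_rng :: "'a operator_rng \<Rightarrow> 'a operator_rng \<Rightarrow> 'a operator_rng" is "(*)"
proof -
  fix u u' v v' :: "'a tensor4" assume *: "operator_rel u u'" "operator_rel v v'"
  have "u * v - u' * v' = (u - u') * v + u' * (v - v')"
    by (simp add: algebra_simps)
  also have "\<dots> \<in> operator_ideal"
    using * operator_ideal_ideal unfolding two_sided_ideal_def operator_rel_def by blast
  finally show "operator_rel (u * v) (u' * v')" by (simp add: operator_rel_def)
qed

instance
proof
  have refl: "operator_rel u u" for u :: "'a tensor4"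
    using operator_rel_equivp by (rule equivp_reflp)
  fix a b c :: "'a operator_rng"
  show "a + b + c = a + (b + c)" by transfer (simp add: add.assoc refl)
  show "a + b = b + a" by transfer (simp add: add.commute refl)
  show "0 + a = a" by transfer (simp add: refl)
  show "- a + a = 0" by transfer (simp add: refl)
  show "a - b = a + - b" by transfer (simp add: refl)
  show "a * b * c = a * (b * c)" by transfer (simp add: mult.assoc refl)
  show "(a + b) * c = a * c + b * c" by transfer (simp add: distrib_right refl)
  show "a * (b + c) = a * b + a * c" by transfer (simp add: distrib_left refl)
qed

end

lemma operator_vector_space: "vector_space (operator_scale :: 'k::field \<Rightarrow> _)"
proof
  interpret T: vector_space "tensor4_scale :: 'k \<Rightarrow> _" by (rule tensor4_vector_space)
  have refl: "operator_rel u u" for u :: "'k tensor4"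
    using operator_rel_equivp by (rule equivp_reflp)
  fix r s :: 'k and x y :: "'k operator_rng"
  show "operator_scale r (x + y) = operator_scale r x + operator_scale r y"
    by transfer (simp add: T.scale_right_distrib refl)
  show "operator_scale (r + s) x = operator_scale r x + operator_scale s x"
    by transfer (simp add: T.scale_left_distrib refl)
  show "operator_scale r (operator_scale s x) = operator_scale (r * s) x"
    by transfer (simp add: refl)
  show "operator_scale 1 x = x"
    by transfer (simp add: refl)
qed

lemma regular_rep_class: "regular_rep (operator_class a \<alpha> b \<beta>) x = tern a \<alpha> b \<beta> x"
  by transfer simp

lemma regular_rep_End: "Vector_Spaces.linear tpm_scale tpm_scale (regular_rep (t :: 'k::field operator_rng))"
  by transfer (rule tensor4_act_vec_linear)

lemma regular_rep_linear:
  "Vector_Spaces.linear operator_scale tpm_scale (\<lambda>t. regular_rep (t :: 'k::field operator_rng) x)"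
proof -
  interpret A: Vector_Spaces.linear "tensor4_scale :: 'k \<Rightarrow> _" tpm_scale "\<lambda>u. tensor4_act u z" for z
    by (rule tensor4_act_linear)
  show ?thesis
  proof (rule vs_linearI[OF operator_vector_space tpm_vector_space])
    show "regular_rep (u + v) x = regular_rep u x + regular_rep v x" for u v
      by transfer (simp add: A.add)
    show "regular_rep (operator_scale r u) x = tpm_scale r (regular_rep u x)" for r u
      by transfer (simp add: A.scale)
  qed
qed

lemma regular_rep_mult: "regular_rep (s * t) = regular_rep s \<circ> regular_rep t"
  by transfer (simp add: fun_eq_iff tensor4_act_mult)

definition defect :: "'k::field operator_rng set" where
  "defect = {t. regular_rep t = (\<lambda>x. 0)}"

lemma defect_subspace: "module.subspace operator_scale (defect :: 'k::field operator_rng set)"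
proof -
  interpret f: vector_space "operator_scale :: 'k \<Rightarrow> _" by (rule operator_vector_space)
  interpret A: Vector_Spaces.linear "operator_scale :: 'k \<Rightarrow> _" tpm_scale "\<lambda>u. regular_rep u z" for z
    by (rule regular_rep_linear)
  show ?thesis
    by (rule f.subspaceI) (auto simp: defect_def fun_eq_iff A.add A.scale A.zero)
qed

text \<open>
  \<open>dim\<close> takes the value \<open>0\<close> on infinite-dimensional spaces, but \<open>'k operator_rng\<close> is a
  quotient of a space of dimension \<open>9\<close>.
\<close>

definition defect_dim :: "'k::field itself \<Rightarrow> nat" where
  "defect_dim _ = vector_space.dim operator_scale (defect :: 'k operator_rng set)"

text \<open>For a type \<open>'p\<close> with a prime number \<open>p\<close> of elements, \<open>'p mod_ring\<close> is the field of integers modulo \<open>p\<close>.\<close>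

definition defect_jump :: "'p::prime_card itself \<Rightarrow> int" where
  "defect_jump _ = int (defect_dim TYPE('p mod_ring)) - int (defect_dim TYPE(rat))"

end

theory Submission
  imports Defs
begin

text \<open>
  Ternary associativity makes the linear span of the associativity relations an ideal, so the
  operator rng is \<open>T \<otimes> T\<close> modulo \<open>f \<otimes> f\<close> and the relations
  \<open>\<mu>\<^sub>i\<^sub>j\<^sub>l f \<otimes> e\<^sub>m = \<mu>\<^sub>j\<^sub>l\<^sub>m e\<^sub>i \<otimes> f\<close>.  If \<open>2 \<noteq> 0\<close>, both signs occur for every pair \<open>(i, m)\<close>
  with \<open>i \<noteq> m\<close>, so all mixed tensors vanish and \<open>E \<otimes> E\<close> remains; it acts through a map of rank
  \<open>2\<close>, which leaves a kernel of dimension \<open>4 - 2\<close>.  If \<open>2 = 0\<close>, then \<open>\<mu>\<close> is the product of the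
  coordinate sums, the four mixed tensors are identified with one nonzero class, and \<open>E \<otimes> E\<close>
  acts through a map of rank \<open>1\<close>, which leaves a kernel of dimension \<open>(4 + 1) - 1\<close>.
\<close>

section \<open>Generalities on vector spaces\<close>

lemma dim_dual_family:
  fixes b :: "'i \<Rightarrow> 'v::ab_group_add" and \<phi> :: "'i \<Rightarrow> 'v \<Rightarrow> 'k::field"
  assumes vs: "vector_space s" and fin: "finite I"
    and lin: "\<And>i. i \<in> I \<Longrightarrow> Vector_Spaces.linear s (*) (\<phi> i)"
    and dual: "\<And>i j. i \<in> I \<Longrightarrow> j \<in> I \<Longrightarrow> \<phi> i (b j) = (if i = j then 1 else 0)"
    and mem: "b ` I \<subseteq> V" and span: "V \<subseteq> module.span s (b ` I)"
  shows "vector_space.dim s V = card I"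
proof -
  interpret vector_space s by fact
  have inj: "inj_on b I"
  proof (rule inj_onI)
    fix i j assume "i \<in> I" "j \<in> I" "b i = b j"
    thus "i = j" using dual[of i i] dual[of i j] by (auto split: if_splits)
  qed
  have "independent (b ` I)"
  proof (rule independent_if_scalars_zero)
    show "finite (b ` I)" using fin by simp
    fix u x assume 0: "(\<Sum>x\<in>b ` I. s (u x) x) = 0" and "x \<in> b ` I"
    then obtain i where i: "i \<in> I" "x = b i" by blast
    interpret L: Vector_Spaces.linear s "(*)" "\<phi> i" using lin i(1) .
    have "0 = \<phi> i (\<Sum>j\<in>I. s (u (b j)) (b j))"
      using 0 by (simp add: sum.reindex[OF inj] L.zero)
    also have "\<dots> = (\<Sum>j\<in>I. if i = j then u (b j) else 0)"
      unfolding L.sum by (intro sum.cong) (auto simp: L.scale dual i(1))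
    also have "\<dots> = u x" using i fin by simp
    finally show "u x = 0" by simp
  qed
  thus ?thesis using dim_unique[OF mem span _ card_image[OF inj]] by simp
qed


section \<open>The operator rng of the ternary algebra\<close>

lemma tensor4_induct:
  fixes t :: "'k::field tensor4"
  assumes "\<And>a \<alpha> b \<beta>. pure4 a \<alpha> b \<beta> \<in> S" "module.subspace tensor4_scale S"
  shows "t \<in> S"
proof -
  interpret T: vector_space "tensor4_scale :: 'k \<Rightarrow> _" by (rule tensor4_vector_space)
  have "u \<in> {u. abs_tensor4 u \<in> S}" for u
  proof (rule free4_induct)
    show "gen4 a \<alpha> b \<beta> \<in> {u. abs_tensor4 u \<in> S}" for a \<alpha> b \<beta>
      using assms(1)[of a \<alpha> b \<beta>] by (simp add: pure4.abs_eq)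
    show "free4.subspace {u. abs_tensor4 u \<in> S}"
      using T.subspace_0[OF assms(2)] T.subspace_add[OF assms(2)] T.subspace_scale[OF assms(2)]
      by (auto intro!: free4.subspaceI simp: zero_tensor4_def
          simp flip: plus_tensor4.abs_eq tensor4_scale.abs_eq)
  qed
  thus ?thesis by (induction t rule: tensor4.abs_induct) simp
qed

lemma operator_induct:
  fixes t :: "'k::field operator_rng"
  assumes "\<And>a \<alpha> b \<beta>. operator_class a \<alpha> b \<beta> \<in> S" "module.subspace operator_scale S"
  shows "t \<in> S"
proof -
  interpret T: vector_space "tensor4_scale :: 'k \<Rightarrow> _" by (rule tensor4_vector_space)
  interpret O: vector_space "operator_scale :: 'k \<Rightarrow> _" by (rule operator_vector_space)
  have "u \<in> {u. abs_operator_rng u \<in> S}" for u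
  proof (rule tensor4_induct)
    show "pure4 a \<alpha> b \<beta> \<in> {u. abs_operator_rng u \<in> S}" for a \<alpha> b \<beta>
      using assms(1)[of a \<alpha> b \<beta>] by (simp add: operator_class.abs_eq)
    show "T.subspace {u. abs_operator_rng u \<in> S}"
      using O.subspace_0[OF assms(2)] O.subspace_add[OF assms(2)] O.subspace_scale[OF assms(2)]
      by (auto intro!: T.subspaceI simp: zero_operator_rng_def
          simp flip: plus_operator_rng.abs_eq operator_scale.abs_eq)
  qed
  thus ?thesis by (induction t rule: operator_rng.abs_induct) simp
qed

text \<open>By the ternary associativity, a product with an associativity relation on the right is again
  an associativity relation, and a product with one on the left vanishes.\<close>

lemma operator_ideal_subset_span:
  "operator_ideal \<subseteq> module.span tensor4_scale (assoc_rels :: 'k::field tensor4 set)"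
proof (rule operator_ideal_minimal)
  interpret T: vector_space "tensor4_scale :: 'k \<Rightarrow> _" by (rule tensor4_vector_space)
  show "assoc_rels \<subseteq> T.span assoc_rels" by (rule T.span_superset)
  have left: "r * x \<in> T.span assoc_rels" if x: "x \<in> T.span assoc_rels" for r x
  proof -
    have gen: "r * x \<in> T.span assoc_rels" if x: "x \<in> assoc_rels" for x
    proof -
      from x obtain a \<alpha> b \<beta> c \<gamma> d \<delta> where
        x: "x = pure4 (tern a \<alpha> b \<beta> c) \<gamma> d \<delta> - pure4 a \<alpha> (tern b \<beta> c \<gamma> d) \<delta>"
        unfolding assoc_rels_def by blast
      have "r \<in> {r. r * x \<in> T.span assoc_rels}"
      proof (rule tensor4_induct)
        fix p q :: "'k tpm" and \<pi> \<kappa> :: 'k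
        have "pure4 p \<pi> q \<kappa> * x = pure4 (tern (tern p \<pi> q \<kappa> a) \<alpha> b \<beta> c) \<gamma> d \<delta>
            - pure4 (tern p \<pi> q \<kappa> a) \<alpha> (tern b \<beta> c \<gamma> d) \<delta>"
          by (simp add: x right_diff_distrib pure4_mult tern_assoc(2))
        also have "\<dots> \<in> assoc_rels" unfolding assoc_rels_def by blast
        finally show "pure4 p \<pi> q \<kappa> \<in> {r. r * x \<in> T.span assoc_rels}"
          by (simp add: T.span_base)
      qed (auto intro!: T.subspaceI T.span_zero T.span_add T.span_scale
            simp: distrib_right simp flip: tensor4_scale_mult(1))
      thus ?thesis by simp
    qed
    have "T.span assoc_rels \<subseteq> {x. r * x \<in> T.span assoc_rels}"
      using gen by (intro T.span_minimal) (auto intro!: T.subspaceI T.span_zero T.span_add T.span_scale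
            simp: distrib_left simp flip: tensor4_scale_mult(2))
    thus ?thesis using x by blast
  qed
  have right: "x * r \<in> T.span assoc_rels" if x: "x \<in> T.span assoc_rels" for r x
  proof -
    have "x * r = 0" if x: "x \<in> assoc_rels" for x
    proof -
      have "r \<in> {r. x * r = 0}"
        by (rule tensor4_induct)
           (use x in \<open>auto simp: assoc_rels_def left_diff_distrib pure4_mult tern_assoc(1)
              distrib_left intro!: T.subspaceI simp flip: tensor4_scale_mult(2)\<close>)
      thus ?thesis by simp
    qed
    hence "T.span assoc_rels \<subseteq> {x. x * r = 0}"
      by (intro T.span_minimal) (auto intro!: T.subspaceI
            simp: distrib_right simp flip: tensor4_scale_mult(1))
    thus ?thesis using x T.span_zero by auto
  qed
  show "two_sided_ideal (T.span assoc_rels)"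
    unfolding two_sided_ideal_def
    using left right by (auto intro: T.span_zero T.span_add T.span_neg)
qed

lemma operator_functional:
  fixes B :: "'k::field tpm \<Rightarrow> 'k tpm \<Rightarrow> 'k"
  assumes lin1: "\<And>d. Vector_Spaces.linear tpm_scale (*) (\<lambda>a. B a d)"
    and lin2: "\<And>a. Vector_Spaces.linear tpm_scale (*) (B a)"
    and bal: "\<And>a b c d. B (tern a 1 b 1 c) d = B a (tern b 1 c 1 d)"
  obtains \<phi> where "Vector_Spaces.linear operator_scale (*) \<phi>"
    and "\<And>a \<alpha> b \<beta>. \<phi> (operator_class a \<alpha> b \<beta>) = \<alpha> * \<beta> * B a b"
proof -
  interpret T: vector_space "tensor4_scale :: 'k \<Rightarrow> _" by (rule tensor4_vector_space)
  interpret B1: Vector_Spaces.linear "tpm_scale :: 'k \<Rightarrow> _" "(*)" "\<lambda>a. B a d" for d by (rule lin1)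
  interpret B2: Vector_Spaces.linear "tpm_scale :: 'k \<Rightarrow> _" "(*)" "B a" for a by (rule lin2)
  define \<psi> :: "'k free4 \<Rightarrow> 'k" where "\<psi> = lin_ext (*) (\<lambda>(a, \<alpha>, b, \<beta>). \<alpha> * \<beta> * B a b)"
  interpret P: Vector_Spaces.linear "free_scale :: 'k \<Rightarrow> 'k free4 \<Rightarrow> _" "(*)" \<psi>
    unfolding \<psi>_def by (rule lin_ext_linear) (rule vector_space_over_itself.vector_space_axioms)
  have \<psi>_gen: "\<psi> (gen4 a \<alpha> b \<beta>) = \<alpha> * \<beta> * B a b" for a \<alpha> b \<beta>
    unfolding \<psi>_def by (simp add: vector_space_over_itself.vector_space_axioms)
  have "\<psi> r = 0" if "r \<in> multilin_rels" for r
    using that by cases (simp_all add: P.diff P.scale \<psi>_gen B1.add B2.add B1.scale B2.scale distrib_left distrib_right mult_ac)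
  hence \<psi>_null: "\<psi> u = 0" if "u \<in> multilin_null" for u
    using that P.eq_0_on_span[of multilin_rels u] unfolding multilin_null_def by blast
  define \<theta> where "\<theta> t = \<psi> (rep_tensor4 t)" for t
  have \<theta>_abs: "\<theta> (abs_tensor4 u) = \<psi> u" for u
  proof -
    have "tensor_rel (rep_tensor4 (abs_tensor4 u)) u"
      using Quotient3_tensor4 equivp_reflp[OF tensor_rel_equivp] by (metis rep_abs_rsp_left)
    thus ?thesis using \<psi>_null unfolding \<theta>_def tensor_rel_def by (metis P.diff eq_iff_diff_eq_0)
  qed
  have \<theta>_lin: "Vector_Spaces.linear tensor4_scale (*) \<theta>"
  proof (rule vs_linearI[OF tensor4_vector_space vector_space_over_itself.vector_space_axioms])
    show "\<theta> (s + t) = \<theta> s + \<theta> t" for s t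
      by (induction s rule: tensor4.abs_induct, induction t rule: tensor4.abs_induct) (simp add: plus_tensor4.abs_eq \<theta>_abs P.add)
    show "\<theta> (tensor4_scale r s) = r * \<theta> s" for r s
      by (induction s rule: tensor4.abs_induct) (simp add: tensor4_scale.abs_eq \<theta>_abs P.scale)
  qed
  interpret X: Vector_Spaces.linear "tensor4_scale :: 'k \<Rightarrow> _" "(*)" \<theta> by (rule \<theta>_lin)
  have \<theta>_pure: "\<theta> (pure4 a \<alpha> b \<beta>) = \<alpha> * \<beta> * B a b" for a \<alpha> b \<beta>
    by (simp add: pure4.abs_eq \<theta>_abs \<psi>_gen)
  have scale1: "tern a \<alpha> b \<beta> c = tpm_scale (\<alpha> * \<beta>) (tern a 1 b 1 c)" for a b c :: "'k tpm" and \<alpha> \<beta>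
    by (simp add: tern_def tpm_scale_def)
  have "\<theta> x = 0" if x: "x \<in> assoc_rels" for x
  proof -
    from x obtain a \<alpha> b \<beta> c \<gamma> d \<delta> where
      "x = pure4 (tern a \<alpha> b \<beta> c) \<gamma> d \<delta> - pure4 a \<alpha> (tern b \<beta> c \<gamma> d) \<delta>"
      unfolding assoc_rels_def by blast
    thus ?thesis
      by (simp add: X.diff \<theta>_pure scale1[of a \<alpha> b \<beta>] scale1[of b \<beta> c \<gamma>] B1.scale B2.scale bal)
  qed
  hence \<theta>_ideal: "\<theta> t = 0" if "t \<in> operator_ideal" for t
    using that X.eq_0_on_span[of assoc_rels t] operator_ideal_subset_span by blast
  define \<phi> where "\<phi> t = \<theta> (rep_operator_rng t)" for t
  have \<phi>_abs: "\<phi> (abs_operator_rng u) = \<theta> u" for u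
  proof -
    have "operator_rel (rep_operator_rng (abs_operator_rng u)) u"
      using Quotient3_operator_rng equivp_reflp[OF operator_rel_equivp] by (metis rep_abs_rsp_left)
    thus ?thesis using \<theta>_ideal unfolding \<phi>_def operator_rel_def by (metis X.diff eq_iff_diff_eq_0)
  qed
  show thesis
  proof (rule that)
    show "Vector_Spaces.linear operator_scale (*) \<phi>"
    proof (rule vs_linearI[OF operator_vector_space vector_space_over_itself.vector_space_axioms])
      show "\<phi> (s + t) = \<phi> s + \<phi> t" for s t
        by (induction s rule: operator_rng.abs_induct, induction t rule: operator_rng.abs_induct) (simp add: plus_operator_rng.abs_eq \<phi>_abs X.add)
      show "\<phi> (operator_scale r s) = r * \<phi> s" for r s
        by (induction s rule: operator_rng.abs_induct) (simp add: operator_scale.abs_eq \<phi>_abs X.scale)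
    qed
    show "\<phi> (operator_class a \<alpha> b \<beta>) = \<alpha> * \<beta> * B a b" for a \<alpha> b \<beta>
      by (simp add: operator_class.abs_eq \<phi>_abs \<theta>_pure)
  qed
qed

lemma pure4_multilinear:
  "pure4 (a + a') \<alpha> b \<beta> = pure4 a \<alpha> b \<beta> + pure4 a' \<alpha> b \<beta>"
  "pure4 a \<alpha> (b + b') \<beta> = pure4 a \<alpha> b \<beta> + pure4 a \<alpha> b' \<beta>"
  "pure4 a \<alpha> (tpm_scale r b) \<beta> = tensor4_scale r (pure4 a \<alpha> b \<beta>)"
  "pure4 a (r * \<alpha>) b \<beta> = tensor4_scale r (pure4 a \<alpha> b \<beta>)"
  "pure4 a \<alpha> b (r * \<beta>) = tensor4_scale r (pure4 a \<alpha> b \<beta>)"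
  unfolding pure4.abs_eq plus_tensor4.abs_eq tensor4_scale.abs_eq tensor4.abs_eq_iff
    tensor_rel_def multilin_null_def diff_diff_eq[symmetric]
  by (rule free4.span_base, rule multilin_rels.intros)+

lemma operator_class_multilinear:
  "operator_class (a + a') \<alpha> b \<beta> = operator_class a \<alpha> b \<beta> + operator_class a' \<alpha> b \<beta>"
  "operator_class a \<alpha> (b + b') \<beta> = operator_class a \<alpha> b \<beta> + operator_class a \<alpha> b' \<beta>"
  "operator_class (tpm_scale r a) \<alpha> b \<beta> = operator_scale r (operator_class a \<alpha> b \<beta>)"
  "operator_class a \<alpha> (tpm_scale r b) \<beta> = operator_scale r (operator_class a \<alpha> b \<beta>)"
  "operator_class a (r * \<alpha>) b \<beta> = operator_scale r (operator_class a \<alpha> b \<beta>)"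
  "operator_class a \<alpha> b (r * \<beta>) = operator_scale r (operator_class a \<alpha> b \<beta>)"
  by (simp_all add: operator_class.abs_eq plus_operator_rng.abs_eq operator_scale.abs_eq
      pure4_multilinear pure4_scale)

lemma operator_class_assoc:
  "operator_class (tern a \<alpha> b \<beta> c) \<gamma> d \<delta> = operator_class a \<alpha> (tern b \<beta> c \<gamma> d) \<delta>"
proof -
  have "pure4 (tern a \<alpha> b \<beta> c) \<gamma> d \<delta> - pure4 a \<alpha> (tern b \<beta> c \<gamma> d) \<delta> \<in> assoc_rels"
    unfolding assoc_rels_def by blast
  thus ?thesis
    using assoc_rels_subset by (auto simp: operator_class.abs_eq operator_rng.abs_eq_iff operator_rel_def)
qed

abbreviation e_tpm :: "2 \<Rightarrow> 'k::field tpm" where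
  "e_tpm i \<equiv> (axis i 1, 0)"

abbreviation f_tpm :: "'k::field tpm" where
  "f_tpm \<equiv> (0, 1)"

abbreviation op_class :: "'k::field tpm \<Rightarrow> 'k tpm \<Rightarrow> 'k operator_rng" where
  "op_class a b \<equiv> operator_class a 1 b 1"

lemma tpm_expand:
  "x = tpm_scale (fst x $ 1) (e_tpm 1) + tpm_scale (fst x $ 2) (e_tpm 2) + tpm_scale (snd x) f_tpm"
proof -
  have "i = 1 \<or> i = 2" for i :: 2 by (rule exhaust_2)
  thus ?thesis by (cases x) (auto simp: tpm_scale_def vec_eq_iff axis_def)
qed

lemma mu_eq: "mu x y z = (x $ 1 + x $ 2) * (y $ 1 + y $ 2) * (z $ 1 + z $ 2) - 2 * (x $ 2 * y $ 2 * z $ 2)"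
  by (simp add: mu_def sum_2 mu_coeff_def algebra_simps)

lemma op_class_f_f: "op_class f_tpm (f_tpm :: 'k::field tpm) = 0"
proof -
  interpret O: vector_space "operator_scale :: 'k \<Rightarrow> _" by (rule operator_vector_space)
  have "op_class (tern (e_tpm 1) 1 (e_tpm 1) 1 (e_tpm 1)) (f_tpm :: 'k tpm)
      = op_class (e_tpm 1) (tpm_scale 0 0)"
    unfolding operator_class_assoc by (simp add: tern_def tpm_scale_def zero_prod_def)
  thus ?thesis by (simp add: operator_class_multilinear tern_def mu_axis mu_coeff_def)
qed

lemma op_class_f_e:
  "operator_scale (of_int (mu_coeff i j l)) (op_class f_tpm (e_tpm m))
    = operator_scale (of_int (mu_coeff j l m)) (op_class (e_tpm i) (f_tpm :: 'k::field tpm))"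
proof -
  have "tern (e_tpm i) 1 (e_tpm j) 1 (e_tpm l) = tpm_scale (of_int (mu_coeff i j l)) (f_tpm :: 'k tpm)"
    for i j l by (simp add: tern_def mu_axis tpm_scale_def)
  thus ?thesis
    using operator_class_assoc[of "e_tpm i" "1::'k" "e_tpm j" 1 "e_tpm l" 1 "e_tpm m" 1]
    by (simp add: operator_class_multilinear)
qed

lemma op_class_expand:
  fixes a b :: "'k::field tpm"
  shows "operator_class a \<alpha> b \<beta> = operator_scale (\<alpha> * \<beta>)
    ((\<Sum>i\<in>UNIV. \<Sum>j\<in>UNIV. operator_scale (fst a $ i * fst b $ j) (op_class (e_tpm i) (e_tpm j)))
     + (\<Sum>i\<in>UNIV. operator_scale (fst a $ i * snd b) (op_class (e_tpm i) f_tpm)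
         + operator_scale (snd a * fst b $ i) (op_class f_tpm (e_tpm i))))"
proof -
  interpret O: vector_space "operator_scale :: 'k \<Rightarrow> _" by (rule operator_vector_space)
  have "operator_class a \<alpha> b \<beta> = operator_scale (\<alpha> * \<beta>) (op_class a b)"
    using operator_class_multilinear(5)[of a \<alpha> 1 b \<beta>] operator_class_multilinear(6)[of a 1 b \<beta> 1] by simp
  thus ?thesis
    by (subst (asm) tpm_expand[of a], subst (asm) tpm_expand[of b])
       (simp add: operator_class_multilinear sum_2 op_class_f_f O.scale_right_distrib mult.commute add_ac)
qed

definition op_coord :: "2 \<Rightarrow> 2 \<Rightarrow> 'k::field operator_rng \<Rightarrow> 'k" where
  "op_coord i j = (SOME \<phi>. Vector_Spaces.linear operator_scale (*) \<phi> \<and>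
     (\<forall>a \<alpha> b \<beta>. \<phi> (operator_class a \<alpha> b \<beta>) = \<alpha> * \<beta> * (fst a $ i * fst b $ j)))"

lemma op_coord:
  shows op_coord_linear: "Vector_Spaces.linear operator_scale (*) (op_coord i j :: 'k::field operator_rng \<Rightarrow> _)"
    and op_coord_class: "op_coord i j (operator_class a \<alpha> b \<beta>) = \<alpha> * \<beta> * (fst (a :: 'k tpm) $ i * fst b $ j)"
proof -
  obtain \<phi> :: "'k operator_rng \<Rightarrow> 'k" where "Vector_Spaces.linear operator_scale (*) \<phi>"
    and "\<And>a \<alpha> b \<beta>. \<phi> (operator_class a \<alpha> b \<beta>) = \<alpha> * \<beta> * (fst a $ i * fst b $ j)"
  proof (rule operator_functional[of "\<lambda>a b. fst a $ i * fst b $ j"])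
    show "Vector_Spaces.linear tpm_scale (*) (\<lambda>a :: 'k tpm. fst a $ i * fst d $ j)" for d :: "'k tpm"
      by (rule vs_linearI[OF tpm_vector_space vector_space_over_itself.vector_space_axioms])
         (simp_all add: tpm_scale_def algebra_simps)
    show "Vector_Spaces.linear tpm_scale (*) (\<lambda>d :: 'k tpm. fst a $ i * fst d $ j)" for a :: "'k tpm"
      by (rule vs_linearI[OF tpm_vector_space vector_space_over_itself.vector_space_axioms])
         (simp_all add: tpm_scale_def algebra_simps)
  qed (simp_all add: tern_def)
  hence "\<exists>\<phi> :: 'k operator_rng \<Rightarrow> 'k. Vector_Spaces.linear operator_scale (*) \<phi> \<and>
     (\<forall>a \<alpha> b \<beta>. \<phi> (operator_class a \<alpha> b \<beta>) = \<alpha> * \<beta> * (fst a $ i * fst b $ j))"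
    by blast
  from someI_ex[OF this]
  show "Vector_Spaces.linear operator_scale (*) (op_coord i j :: 'k operator_rng \<Rightarrow> _)"
    and "op_coord i j (operator_class a \<alpha> b \<beta>) = \<alpha> * \<beta> * (fst (a :: 'k tpm) $ i * fst b $ j)"
    unfolding op_coord_def by blast+
qed

lemma regular_rep_eq:
  fixes t :: "'k::field operator_rng"
  shows "regular_rep t x =
    (0, (\<Sum>i\<in>UNIV. \<Sum>j\<in>UNIV. op_coord i j t) * (fst x $ 1 + fst x $ 2) - 2 * op_coord 2 2 t * fst x $ 2)"
proof -
  interpret O: vector_space "operator_scale :: 'k \<Rightarrow> _" by (rule operator_vector_space)
  interpret R: Vector_Spaces.linear "operator_scale :: 'k \<Rightarrow> _" tpm_scale "\<lambda>t. regular_rep t x"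
    by (rule regular_rep_linear)
  interpret P: Vector_Spaces.linear "operator_scale :: 'k \<Rightarrow> _" "(*)" "op_coord i j" for i j
    by (rule op_coord_linear)
  have "t \<in> {t. regular_rep t x =
    (0, (\<Sum>i\<in>UNIV. \<Sum>j\<in>UNIV. op_coord i j t) * (fst x $ 1 + fst x $ 2) - 2 * op_coord 2 2 t * fst x $ 2)}"
  proof (rule operator_induct)
    fix a \<alpha> b \<beta>
    show "operator_class a \<alpha> b \<beta> \<in> {t. regular_rep t x =
      (0, (\<Sum>i\<in>UNIV. \<Sum>j\<in>UNIV. op_coord i j t) * (fst x $ 1 + fst x $ 2) - 2 * op_coord 2 2 t * fst x $ 2)}"
      by (simp add: regular_rep_class op_coord_class tern_def mu_eq sum_2 algebra_simps)
  qed (auto intro!: O.subspaceI simp: R.add R.zero R.scale P.add P.zero P.scale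
        zero_prod_def tpm_scale_def sum_2 algebra_simps)
  thus ?thesis by simp
qed

lemma defect_iff:
  "t \<in> defect \<longleftrightarrow> (\<Sum>i\<in>UNIV. \<Sum>j\<in>UNIV. op_coord i j t) = 0 \<and> 2 * op_coord 2 2 t = 0"
  (is "_ \<longleftrightarrow> ?s = 0 \<and> ?d = 0")
proof
  assume "t \<in> defect"
  hence "regular_rep t (e_tpm l) = 0" for l by (simp add: defect_def)
  from this[of 1] this[of 2] show "?s = 0 \<and> ?d = 0"
    by (simp add: regular_rep_eq zero_prod_def axis_def)
qed (simp add: defect_def regular_rep_eq zero_prod_def fun_eq_iff)


section \<open>The dimension of the defect\<close>

lemma defect_dim_odd:
  assumes "(2::'k::field) \<noteq> 0"
  shows "defect_dim TYPE('k) = 2"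
proof -
  interpret O: vector_space "operator_scale :: 'k \<Rightarrow> _" by (rule operator_vector_space)
  interpret P: Vector_Spaces.linear "operator_scale :: 'k \<Rightarrow> _" "(*)" "op_coord i j" for i j
    by (rule op_coord_linear)
  let ?e = "e_tpm :: 2 \<Rightarrow> 'k tpm" and ?f = "f_tpm :: 'k tpm"
  have neg: "x = 0" if "x = - x" for x :: "'k operator_rng"
  proof -
    from that have "x + x = 0" by (metis add.right_inverse)
    hence "operator_scale (1 + 1) x = 0" by (simp only: O.scale_left_distrib O.scale_one)
    with assms show ?thesis by (simp add: O.scale_eq_0_iff)
  qed
  have fe2: "op_class ?f (?e 2) = op_class (?e 1) ?f" "op_class ?f (?e 2) = - op_class (?e 1) ?f"
    using op_class_f_e[of 1 1 1 2, where 'k = 'k] op_class_f_e[of 1 2 2 2, where 'k = 'k]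
    by (simp_all add: mu_coeff_def)
  have fe1: "op_class ?f (?e 1) = op_class (?e 2) ?f" "- op_class ?f (?e 1) = op_class (?e 2) ?f"
    using op_class_f_e[of 2 1 1 1, where 'k = 'k] op_class_f_e[of 2 2 2 1, where 'k = 'k]
    by (simp_all add: mu_coeff_def)
  have zero: "op_class ?f (?e i) = 0 \<and> op_class (?e i) ?f = 0" for i
    using exhaust_2[of i] fe1 fe2 neg by metis
  define R where "R t = (\<Sum>i\<in>UNIV. \<Sum>j\<in>UNIV. operator_scale (op_coord i j t) (op_class (?e i) (?e j)))" for t
  have "t \<in> {t. R t = t}" for t
  proof (rule operator_induct)
    fix a b :: "'k tpm" and \<alpha> \<beta>
    show "operator_class a \<alpha> b \<beta> \<in> {t. R t = t}"
      unfolding mem_Collect_eq R_def op_coord_class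
      by (subst op_class_expand[of a \<alpha> b \<beta>])
         (simp add: zero sum_2 O.scale_right_distrib O.scale_left_distrib distrib_left distrib_right ac_simps)
    have "R 0 = 0" by (simp add: R_def P.zero)
    moreover have "R (x + y) = R x + R y" for x y
      by (simp add: R_def P.add O.scale_left_distrib sum.distrib)
    moreover have "R (operator_scale c x) = operator_scale c (R x)" for c x
      by (simp add: R_def P.scale O.scale_right_distrib O.scale_sum_right)
    ultimately show "O.subspace {t. R t = t}"
      by (simp add: O.subspace_def)
  qed
  hence expand: "t = (\<Sum>i\<in>UNIV. \<Sum>j\<in>UNIV. operator_scale (op_coord i j t) (op_class (?e i) (?e j)))" for t
    using R_def by simp
  let ?I = "{(1, 2), (2, 1)} :: (2 \<times> 2) set"
  let ?b = "\<lambda>(i, j). op_class (?e i) (?e j) - op_class (?e 1) (?e 1)"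
  have "O.dim defect = card ?I"
  proof (rule dim_dual_family[where b = ?b and \<phi> = "\<lambda>(i, j). op_coord i j", OF operator_vector_space])
    show "?b ` ?I \<subseteq> defect"
      by (auto simp: defect_iff P.diff op_coord_class sum_2 axis_def)
    show "defect \<subseteq> O.span (?b ` ?I)"
    proof
      fix t :: "'k operator_rng" assume "t \<in> defect"
      hence 22: "op_coord 2 2 t = 0" and "(op_coord 1 2 t + op_coord 2 1 t) + op_coord 1 1 t = 0"
        using assms by (auto simp: defect_iff sum_2 ac_simps)
      from this(2) have 11: "op_coord 1 1 t = - (op_coord 1 2 t + op_coord 2 1 t)"
        by (simp only: add_eq_0_iff)
      have "t = operator_scale (op_coord 1 2 t) (?b (1, 2)) + operator_scale (op_coord 2 1 t) (?b (2, 1))"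
        by (subst expand[of t]) (simp add: sum_2 22 11 O.scale_right_diff_distrib O.scale_left_distrib
            O.scale_left_diff_distrib algebra_simps)
      thus "t \<in> O.span (?b ` ?I)"
        by (metis (no_types, lifting) O.span_add O.span_scale O.span_base image_eqI insertCI)
    qed
  qed (auto simp: op_coord_linear P.diff op_coord_class axis_def)
  thus ?thesis by (simp add: defect_dim_def)
qed

lemma defect_dim_even:
  assumes two: "(2::'k::field) = 0"
  shows "defect_dim TYPE('k) = 4"
proof -
  interpret O: vector_space "operator_scale :: 'k \<Rightarrow> _" by (rule operator_vector_space)
  interpret P: Vector_Spaces.linear "operator_scale :: 'k \<Rightarrow> _" "(*)" "op_coord i j" for i j
    by (rule op_coord_linear)
  let ?e = "e_tpm :: 2 \<Rightarrow> 'k tpm" and ?f = "f_tpm :: 'k tpm"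
  obtain \<psi> :: "'k operator_rng \<Rightarrow> 'k" where \<psi>_lin: "Vector_Spaces.linear operator_scale (*) \<psi>"
    and \<psi>_class: "\<And>a \<alpha> b \<beta>. \<psi> (operator_class a \<alpha> b \<beta>)
      = \<alpha> * \<beta> * (snd a * (fst b $ 1 + fst b $ 2) + (fst a $ 1 + fst a $ 2) * snd b)"
  proof (rule operator_functional[of "\<lambda>a b. snd a * (fst b $ 1 + fst b $ 2) + (fst a $ 1 + fst a $ 2) * snd b"])
    show "Vector_Spaces.linear tpm_scale (*)
        (\<lambda>a :: 'k tpm. snd a * (fst d $ 1 + fst d $ 2) + (fst a $ 1 + fst a $ 2) * snd d)" for d :: "'k tpm"
      by (rule vs_linearI[OF tpm_vector_space vector_space_over_itself.vector_space_axioms])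
         (simp_all add: tpm_scale_def algebra_simps)
    show "Vector_Spaces.linear tpm_scale (*)
        (\<lambda>d :: 'k tpm. snd a * (fst d $ 1 + fst d $ 2) + (fst a $ 1 + fst a $ 2) * snd d)" for a :: "'k tpm"
      by (rule vs_linearI[OF tpm_vector_space vector_space_over_itself.vector_space_axioms])
         (simp_all add: tpm_scale_def algebra_simps)
  qed (simp_all add: tern_def mu_eq two)
  interpret X: Vector_Spaces.linear "operator_scale :: 'k \<Rightarrow> _" "(*)" \<psi> by (rule \<psi>_lin)
  have "- 1 = (1::'k)" using two by (simp add: neg_eq_iff_add_eq_0 one_add_one)
  hence coeff: "of_int (mu_coeff i j l) = (1::'k)" for i j l
    by (simp add: mu_coeff_def)
  define g where "g = op_class ?f (?e 1)"
  have "op_class ?f (?e m) = op_class (?e i) ?f" for i m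
    using op_class_f_e[of i 1 1 m, where 'k = 'k] by (simp add: coeff)
  hence fe: "op_class ?f (?e i) = g" "op_class (?e i) ?f = g" for i
    unfolding g_def by metis+
  define R where "R t = (\<Sum>i\<in>UNIV. \<Sum>j\<in>UNIV. operator_scale (op_coord i j t) (op_class (?e i) (?e j)))
      + operator_scale (\<psi> t) g" for t
  have "t \<in> {t. R t = t}" for t
  proof (rule operator_induct)
    fix a b :: "'k tpm" and \<alpha> \<beta>
    show "operator_class a \<alpha> b \<beta> \<in> {t. R t = t}"
      unfolding mem_Collect_eq R_def op_coord_class \<psi>_class
      by (subst op_class_expand[of a \<alpha> b \<beta>])
         (simp add: fe sum_2 O.scale_right_distrib O.scale_left_distrib distrib_left distrib_right ac_simps)
    have "R 0 = 0" by (simp add: R_def P.zero X.zero)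
    moreover have "R (x + y) = R x + R y" for x y
      by (simp add: R_def P.add X.add O.scale_left_distrib sum.distrib)
    moreover have "R (operator_scale c x) = operator_scale c (R x)" for c x
      by (simp add: R_def P.scale X.scale O.scale_right_distrib O.scale_sum_right)
    ultimately show "O.subspace {t. R t = t}"
      by (simp add: O.subspace_def)
  qed
  hence expand: "t = (\<Sum>i\<in>UNIV. \<Sum>j\<in>UNIV. operator_scale (op_coord i j t) (op_class (?e i) (?e j)))
      + operator_scale (\<psi> t) g" for t
    using R_def by simp
  let ?I = "{None, Some (1, 2), Some (2, 1), Some (2, 2)} :: (2 \<times> 2) option set"
  let ?b = "\<lambda>x. case x of None \<Rightarrow> g | Some (i, j) \<Rightarrow> op_class (?e i) (?e j) - op_class (?e 1) (?e 1)"
  let ?\<phi> = "\<lambda>x. case x of None \<Rightarrow> \<psi> | Some (i, j) \<Rightarrow> op_coord i j"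
  have "O.dim defect = card ?I"
  proof (rule dim_dual_family[where b = ?b and \<phi> = ?\<phi>, OF operator_vector_space])
    show "?b ` ?I \<subseteq> defect"
      by (auto simp: defect_iff P.diff op_coord_class g_def sum_2 axis_def two)
    show "defect \<subseteq> O.span (?b ` ?I)"
    proof
      fix t :: "'k operator_rng" assume "t \<in> defect"
      hence "(op_coord 1 2 t + op_coord 2 1 t + op_coord 2 2 t) + op_coord 1 1 t = 0"
        by (auto simp: defect_iff sum_2 ac_simps)
      hence 11: "op_coord 1 1 t = - (op_coord 1 2 t + op_coord 2 1 t + op_coord 2 2 t)"
        by (simp only: add_eq_0_iff)
      have "t = operator_scale (op_coord 1 2 t) (?b (Some (1, 2))) + operator_scale (op_coord 2 1 t) (?b (Some (2, 1)))
          + operator_scale (op_coord 2 2 t) (?b (Some (2, 2))) + operator_scale (\<psi> t) (?b None)"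
        by (subst expand[of t]) (simp add: sum_2 11 O.scale_right_diff_distrib O.scale_left_distrib
            O.scale_left_diff_distrib algebra_simps)
      also have "\<dots> \<in> O.span (?b ` ?I)"
        by (intro O.span_add O.span_scale O.span_base imageI) auto
      finally show "t \<in> O.span (?b ` ?I)" .
    qed
  qed (auto simp: op_coord_linear \<psi>_lin P.diff X.diff op_coord_class \<psi>_class g_def axis_def)
  thus ?thesis by (simp add: defect_dim_def)
qed

theorem proposition16p3:
  shows "(odd CARD('p::prime_card) \<longrightarrow> defect_dim TYPE('p mod_ring) = 2) \<and>
         (CARD('p) = 2 \<longrightarrow> defect_dim TYPE('p mod_ring) = 4 \<and> defect_jump TYPE('p) = 2)"
proof -
  have two: "(2 :: 'p mod_ring) = 0 \<longleftrightarrow> CARD('p) dvd 2"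
    using of_nat_eq_0_iff_char_dvd[of 2, where 'a = "'p mod_ring"] by simp
  have "\<not> CARD('p) dvd 2" if "odd CARD('p)"
    using that primes_dvd_imp_eq[OF prime_card two_is_prime_nat, where 'a1 = 'p] by auto
  thus ?thesis
    using two by (simp add: defect_dim_odd defect_dim_even defect_jump_def)
qed

end
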